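(* Let $G$ be the semigroup (under composition) of all linear fractional transformations of the form $$\theta \mapsto \theta' = \frac{a\theta+b}{c\theta+d}, \qquad \begin{bmatrix} a & b\\ c& d\end{bmatrix}\in GL_2(\mathbb{Z})/\{\pm I\},$$ which map the interval $[0,1]$ into itself. Then $G$ is generated, as a semigroup, by the two maps $\phi(\theta)=\theta/(\theta+1)$ and $\psi(\theta)=1-\theta$, which are represented respectively by the matrices $$A=\begin{bmatrix}1&0\\1&1\end{bmatrix}\qquad\text{and}\qquad B=\begin{bmatrix}-1&1\\0&1\end{bmatrix}.$$
   Context: $GL_2(\mathbb{Z})$ is the group of $2\times 2$ integer matrices with determinant $\pm1$. A matrix and its negative represent the same linear fractional transformation, so transformations are indexed by $GL_2(\mathbb{Z})/\{\pm I\}$; composition of transformations corresponds to matrix multiplication. "Maps $[0,1]$ into itself" includes that the transformation has no pole in $[0,1]$. *)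

theory Defs
  imports "HOL-Analysis.Analysis" "HOL-Algebra.Coset"
begin

definition GL2Z :: "(int^2^2) monoid" where
  "GL2Z = \<lparr>carrier = {M. det M = 1 \<or> det M = -1}, mult = (**), one = mat 1\<rparr>"

definition PGL2Z :: "(int^2^2) set monoid" where
  "PGL2Z = GL2Z Mod {mat 1, - mat 1}"

definition mat_class :: "int^2^2 \<Rightarrow> (int^2^2) set" where
  "mat_class M = {mat 1, - mat 1} #>\<^bsub>GL2Z\<^esub> M"

text \<open>A linear fractional transformation is a self-map of the real projective line, modelled
  as the type \<open>real option\<close> with \<open>None\<close> the point at infinity.  Thus transformations compose
  by ordinary function composition, also across poles.\<close>

definition lft :: "int^2^2 \<Rightarrow> real option \<Rightarrow> real option" where
  "lft M x =
    (let a = real_of_int (M$1$1); b = real_of_int (M$1$2);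
         c = real_of_int (M$2$1); d = real_of_int (M$2$2)
     in case x of
          Some \<theta> \<Rightarrow> if c * \<theta> + d = 0 then None else Some ((a * \<theta> + b) / (c * \<theta> + d))
        | None \<Rightarrow> if c = 0 then None else Some (a / c))"

definition represents :: "(int^2^2) set \<Rightarrow> (real option \<Rightarrow> real option) \<Rightarrow> bool" where
  "represents X f \<longleftrightarrow> X \<in> carrier PGL2Z \<and> (\<forall>M\<in>X. f = lft M)"

text \<open>Since \<open>None\<close> is not in the target, the inclusion below excludes poles in \<open>[0,1]\<close>.\<close>

definition maps_unit_interval :: "(real option \<Rightarrow> real option) \<Rightarrow> bool" where
  "maps_unit_interval f \<longleftrightarrow> f ` Some ` {0..1} \<subseteq> Some ` {0..1}"

definition lft_semigroup :: "(real option \<Rightarrow> real option) set" where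
  "lft_semigroup = {f. (\<exists>X. represents X f) \<and> maps_unit_interval f}"

inductive_set semigroup_generated :: "('a \<Rightarrow> 'a) set \<Rightarrow> ('a \<Rightarrow> 'a) set"
  for S :: "('a \<Rightarrow> 'a) set" where
  gen: "f \<in> S \<Longrightarrow> f \<in> semigroup_generated S"
| comp: "f \<in> semigroup_generated S \<Longrightarrow> g \<in> semigroup_generated S \<Longrightarrow>
    f \<circ> g \<in> semigroup_generated S"

definition phi :: "real option \<Rightarrow> real option" where
  "phi x = (case x of
      Some \<theta> \<Rightarrow> if \<theta> = -1 then None else Some (\<theta> / (\<theta> + 1))
    | None \<Rightarrow> Some 1)"

definition psi :: "real option \<Rightarrow> real option" where
  "psi x = (case x of Some \<theta> \<Rightarrow> Some (1 - \<theta>) | None \<Rightarrow> None)"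

definition mat_A :: "int^2^2" where
  "mat_A = vector [vector [1, 0], vector [1, 1]]"

definition mat_B :: "int^2^2" where
  "mat_B = vector [vector [-1, 1], vector [0, 1]]"

text \<open>Sanity checks for the encoding.\<close>

lemma group_GL2Z: "group GL2Z"
proof (rule groupI)
  fix M assume M: "M \<in> carrier GL2Z"
  let ?N = "(\<chi> i j. det M * (if i = 1 then (if j = 1 then M$2$2 else - M$1$2)
                               else (if j = 1 then - M$2$1 else M$1$1))) :: int^2^2"
  have "det M * det M = 1" using M by (auto simp: GL2Z_def)
  moreover have "?N ** M = (\<chi> i j. if i = j then det M * det M else 0)"
    by (simp add: vec_eq_iff forall_2 matrix_matrix_mult_def sum_2 det_2 algebra_simps)
  ultimately have "?N ** M = mat 1" by (simp only: mat_def)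
  then obtain N where NM: "N ** M = mat 1" by blast
  then have "det N * det M = 1" using det_mul[of N M] by (simp add: det_I)
  moreover have "det M = 1 \<or> det M = -1" using M by (simp add: GL2Z_def)
  ultimately have "det N = 1 \<or> det N = -1" by auto
  with NM show "\<exists>N\<in>carrier GL2Z. N \<otimes>\<^bsub>GL2Z\<^esub> M = \<one>\<^bsub>GL2Z\<^esub>" by (auto simp: GL2Z_def)
qed (auto simp: GL2Z_def det_mul matrix_mul_assoc)

lemma mat_class_eq: "mat_class M = {M, - M}"
proof -
  have "(- mat 1) ** M = - M"
    by (simp add: vec_eq_iff forall_2 matrix_matrix_mult_def sum_2 mat_def)
  then show ?thesis by (auto simp: mat_class_def r_coset_def GL2Z_def)
qed

lemma normal_pm_one: "{mat 1, - mat 1} \<lhd> GL2Z"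
proof -
  interpret group GL2Z by (rule group_GL2Z)
  have sub: "subgroup {mat 1, - mat 1} GL2Z"
  proof (rule subgroupI)
    have neg: "(- mat 1 :: int^2^2) \<in> carrier GL2Z"
      by (simp add: GL2Z_def det_2 mat_def)
    have sq: "(- mat 1 :: int^2^2) \<otimes>\<^bsub>GL2Z\<^esub> (- mat 1) = \<one>\<^bsub>GL2Z\<^esub>"
      by (simp add: GL2Z_def vec_eq_iff forall_2 matrix_matrix_mult_def sum_2 mat_def)
    have invn: "inv\<^bsub>GL2Z\<^esub> (- mat 1) = - mat 1"
      using inv_equality[OF sq neg neg] .
    have one: "inv\<^bsub>GL2Z\<^esub> (mat 1) = mat 1"
      using inv_one by (simp add: GL2Z_def)
    show "{mat 1, - mat 1} \<subseteq> carrier GL2Z" using neg by (simp add: GL2Z_def)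
    show "inv\<^bsub>GL2Z\<^esub> a \<in> {mat 1, - mat 1}" if "a \<in> {mat 1, - mat 1}" for a
      using that invn one by auto
    show "a \<otimes>\<^bsub>GL2Z\<^esub> b \<in> {mat 1, - mat 1}"
      if "a \<in> {mat 1, - mat 1}" "b \<in> {mat 1, - mat 1}" for a b
      using that sq by (auto simp: GL2Z_def)
  qed auto
  have "M <#\<^bsub>GL2Z\<^esub> {mat 1, - mat 1} = {mat 1, - mat 1} #>\<^bsub>GL2Z\<^esub> M" for M
  proof -
    have "M ** (- mat 1) = - M" "(- mat 1) ** M = - M"
      by (simp_all add: vec_eq_iff forall_2 matrix_matrix_mult_def sum_2 mat_def)
    then show ?thesis by (auto simp: l_coset_def r_coset_def GL2Z_def)
  qed
  with sub show ?thesis by (auto intro: normalI)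
qed

lemma carrier_PGL2Z: "carrier PGL2Z = mat_class ` carrier GL2Z"
  by (auto simp: PGL2Z_def FactGroup_def RCOSETS_def mat_class_def)

definition proj_pt :: "real \<Rightarrow> real \<Rightarrow> real option" where
  "proj_pt u v = (if v = 0 then None else Some (u / v))"

lemma proj_pt_cases:
  obtains u v where "x = proj_pt u v" "u \<noteq> 0 \<or> v \<noteq> 0"
proof (cases x)
  case None
  then show ?thesis using that[of 1 0] by (simp add: proj_pt_def)
next
  case (Some t)
  then show ?thesis using that[of t 1] by (simp add: proj_pt_def)
qed

lemma lft_proj_pt:
  assumes "u \<noteq> 0 \<or> v \<noteq> 0"
  shows "lft M (proj_pt u v) = proj_pt (of_int (M$1$1) * u + of_int (M$1$2) * v)
                                       (of_int (M$2$1) * u + of_int (M$2$2) * v)"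
proof (cases "v = 0")
  case True
  then show ?thesis using assms by (simp add: lft_def proj_pt_def Let_def)
next
  case False
  then have "p * (u / v) + q = (p * u + q * v) / v" for p q :: real
    by (simp add: field_simps)
  then show ?thesis using False by (simp add: lft_def proj_pt_def Let_def)
qed

lemma lft_uminus: "lft (- M) = lft M"
proof
  fix x
  obtain u v where x: "x = proj_pt u v" and uv: "u \<noteq> 0 \<or> v \<noteq> 0" by (rule proj_pt_cases)
  have "proj_pt (- p) (- q) = proj_pt p q" for p q by (simp add: proj_pt_def)
  from this[of "of_int (M$1$1) * u + of_int (M$1$2) * v" "of_int (M$2$1) * u + of_int (M$2$2) * v"]
  show "lft (- M) x = lft M x" by (simp add: x lft_proj_pt[OF uv])
qed

lemma represents_iff: "represents X f \<longleftrightarrow> (\<exists>M\<in>carrier GL2Z. X = mat_class M \<and> f = lft M)"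
  by (auto simp: represents_def carrier_PGL2Z mat_class_eq lft_uminus)

lemma lft_mult:
  assumes "N \<in> carrier GL2Z"
  shows "lft (M ** N) = lft M \<circ> lft N"
proof
  fix x
  obtain u v where x: "x = proj_pt u v" and uv: "u \<noteq> 0 \<or> v \<noteq> 0" by (rule proj_pt_cases)
  define a b c d where abcd: "a = real_of_int (N$1$1)" "b = real_of_int (N$1$2)"
    "c = real_of_int (N$2$1)" "d = real_of_int (N$2$2)"
  have "a * d - b * c = of_int (det N)" by (simp add: abcd det_2)
  then have D: "a * d - b * c \<noteq> 0" using assms by (auto simp: GL2Z_def)
  have "(a * d - b * c) * u = d * (a * u + b * v) - b * (c * u + d * v)"
    "(a * d - b * c) * v = a * (c * u + d * v) - c * (a * u + b * v)"
    by (simp_all add: algebra_simps)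
  then have "a * u + b * v \<noteq> 0 \<or> c * u + d * v \<noteq> 0"
    using D uv by auto
  from lft_proj_pt[OF this, of M] show "lft (M ** N) x = (lft M \<circ> lft N) x"
    by (simp add: x lft_proj_pt[OF uv] matrix_matrix_mult_def sum_2 abcd[symmetric]
        algebra_simps)
qed

lemma lft_eq_id:
  assumes "K \<in> carrier GL2Z" "lft K = id"
  shows "K = mat 1 \<or> K = - mat 1"
proof -
  have c: "K$2$1 = 0"
    using fun_cong[OF assms(2), of None] by (auto simp: lft_def split: if_splits)
  have b: "K$1$2 = 0"
    using fun_cong[OF assms(2), of "Some 0"] by (auto simp: lft_def split: if_splits)
  have ad: "K$1$1 = K$2$2"
    using fun_cong[OF assms(2), of "Some 1"] b c by (auto simp: lft_def split: if_splits)
  have "K$2$2 * K$2$2 = 1 \<or> K$2$2 * K$2$2 = -1"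
    using assms(1) b c ad by (auto simp: GL2Z_def det_2)
  moreover have "K$2$2 * K$2$2 \<ge> 0" by simp
  ultimately have "K$2$2 = 1 \<or> K$2$2 = -1" using square_eq_1_iff by fastforce
  then show ?thesis using b c ad by (auto simp: vec_eq_iff forall_2 mat_def)
qed

lemma lft_eq_iff:
  assumes M: "M \<in> carrier GL2Z" and N: "N \<in> carrier GL2Z"
  shows "lft M = lft N \<longleftrightarrow> mat_class M = mat_class N"
proof
  interpret group GL2Z by (rule group_GL2Z)
  assume eq: "lft M = lft N"
  have "lft (mat 1) = id" by (auto simp: lft_def mat_def fun_eq_iff split: option.split)
  let ?I = "inv\<^bsub>GL2Z\<^esub> N"
  have I: "?I ** N = mat 1" "N ** ?I = mat 1"
    using l_inv[OF N] r_inv[OF N] by (auto simp: GL2Z_def)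
  have "lft (?I ** M) = id"
    using eq I lft_mult[OF M] lft_mult[OF N] \<open>lft (mat 1) = id\<close> by metis
  moreover have "?I ** M \<in> carrier GL2Z"
    using m_closed[OF inv_closed[OF N] M] by (simp add: GL2Z_def)
  ultimately have "?I ** M = mat 1 \<or> ?I ** M = - mat 1" by (rule lft_eq_id[rotated])
  moreover have "N ** (?I ** M) = M" by (simp add: matrix_mul_assoc I)
  moreover have "N ** (- mat 1) = - N"
    by (simp add: vec_eq_iff forall_2 matrix_matrix_mult_def sum_2 mat_def)
  ultimately have "M = N \<or> M = - N" by (metis matrix_mul_rid)
  then show "mat_class M = mat_class N" by (auto simp: mat_class_eq)
next
  assume "mat_class M = mat_class N"
  then have "M = N \<or> M = - N" by (auto simp: mat_class_eq doubleton_eq_iff)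
  then show "lft M = lft N" by (auto simp: lft_uminus)
qed

end

theory Submission
  imports Defs
begin

text \<open>A transformation in \<open>G\<close> is determined by its endpoint values \<open>p/q = b/d\<close> and
  \<open>r/s = (a+b)/(c+d)\<close>, fractions in \<open>[0,1]\<close> with \<open>q r - p s = \<plusminus>1\<close>, that is, Farey neighbours.
  Unless \<open>q = s = 1\<close>, neighbours cannot lie strictly on different sides of \<open>1/2\<close>.  If both are
  at most \<open>1/2\<close>, then \<open>\<phi>\<close> can be split off on the left, which replaces the denominators by
  \<open>q - p\<close> and \<open>s - r\<close>; otherwise splitting off \<open>\<psi>\<close> leads to that case.  The descent is on
  \<open>q + s\<close>.\<close>

lemma mat_A_carrier: "mat_A \<in> carrier GL2Z"
  by (simp add: GL2Z_def det_2 mat_A_def)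

lemma mat_B_carrier: "mat_B \<in> carrier GL2Z"
  by (simp add: GL2Z_def det_2 mat_B_def)

lemma lft_mat_A: "lft mat_A = phi"
  by (auto simp: fun_eq_iff lft_def phi_def mat_A_def Let_def add_eq_0_iff2 split: option.split)

lemma lft_mat_B: "lft mat_B = psi"
  by (auto simp: fun_eq_iff lft_def psi_def mat_B_def split: option.split)

lemma psi_psi: "psi \<circ> psi = id"
  by (auto simp: fun_eq_iff psi_def split: option.split)

text \<open>\<open>semigroup_generated\<close> has no built-in identity; the involution
  \<open>psi\<close> supplies the one with which the descent can end.\<close>

lemma id_generated: "id \<in> semigroup_generated {phi, psi}"
  using semigroup_generated.comp[of psi "{phi, psi}" psi] psi_psi
  by (simp add: semigroup_generated.gen)

lemma lft_mat_1: "lft (mat 1) = id"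
  by (auto simp: lft_def mat_def fun_eq_iff split: option.split)

lemma maps_unit_interval_comp:
  "maps_unit_interval f \<Longrightarrow> maps_unit_interval g \<Longrightarrow> maps_unit_interval (f \<circ> g)"
  unfolding maps_unit_interval_def by (fastforce simp: image_subset_iff)

lemma lft_semigroup_iff:
  "f \<in> lft_semigroup \<longleftrightarrow> (\<exists>M\<in>carrier GL2Z. f = lft M) \<and> maps_unit_interval f"
  by (auto simp: lft_semigroup_def represents_iff)

lemma phi_in_lft_semigroup: "phi \<in> lft_semigroup"
proof -
  have "maps_unit_interval phi"
    by (auto simp: maps_unit_interval_def phi_def)
  then show ?thesis
    using mat_A_carrier lft_mat_A[symmetric] by (auto simp: lft_semigroup_iff)
qed

lemma psi_in_lft_semigroup: "psi \<in> lft_semigroup"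
proof -
  have "maps_unit_interval psi"
    by (auto simp: maps_unit_interval_def psi_def)
  then show ?thesis
    using mat_B_carrier lft_mat_B[symmetric] by (auto simp: lft_semigroup_iff)
qed

lemma comp_in_lft_semigroup:
  assumes "f \<in> lft_semigroup" "g \<in> lft_semigroup"
  shows "f \<circ> g \<in> lft_semigroup"
proof -
  obtain M N where M: "M \<in> carrier GL2Z" "f = lft M" and N: "N \<in> carrier GL2Z" "g = lft N"
    using assms by (auto simp: lft_semigroup_iff)
  have "M ** N \<in> carrier GL2Z"
    using group.subgroup_self[OF group_GL2Z, THEN subgroup.m_closed, OF M(1) N(1)]
    by (simp add: GL2Z_def)
  moreover have "f \<circ> g = lft (M ** N)"
    using M N by (simp add: lft_mult)
  moreover have "maps_unit_interval (f \<circ> g)"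
    using assms by (simp add: lft_semigroup_iff maps_unit_interval_comp)
  ultimately show ?thesis
    by (auto simp: lft_semigroup_iff)
qed

text \<open>Positive denominators at both endpoints select one of the representatives
  \<open>M\<close> and \<open>- M\<close>, and turn the bounds on the endpoint values into linear
  integer inequalities.\<close>

definition farey :: "int^2^2 \<Rightarrow> bool" where
  "farey M \<longleftrightarrow> M \<in> carrier GL2Z \<and> 0 < M$2$2 \<and> 0 < M$2$1 + M$2$2 \<and>
     0 \<le> M$1$2 \<and> M$1$2 \<le> M$2$2 \<and>
     0 \<le> M$1$1 + M$1$2 \<and> M$1$1 + M$1$2 \<le> M$2$1 + M$2$2"

lemma farey_straddles_half:
  assumes M: "farey M" and lo: "2 * M$1$2 < M$2$2" and hi: "M$2$1 + M$2$2 < 2 * (M$1$1 + M$1$2)"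
  shows "M = mat 1"
proof -
  define p q r s where pqrs: "p = M$1$2" "q = M$2$2" "r = M$1$1 + M$1$2" "s = M$2$1 + M$2$2"
  have *: "q \<ge> 1" "s \<ge> 1" "p \<ge> 0" "p \<le> q" "r \<ge> 0" "r \<le> s" "2 * p < q" "s < 2 * r"
    using M lo hi by (auto simp: farey_def pqrs)
  have "q * r - p * s = det M"
    by (simp add: pqrs det_2 algebra_simps)
  then have le1: "q * r - p * s \<le> 1"
    using M by (auto simp: farey_def GL2Z_def)
  \<comment> \<open>By integrality the strict inequalities give 2r - s >= 1 and q - 2p >= 1. The
    terms in qs cancel, leaving twice the determinant.\<close>
  have "q * 1 + s * 1 \<le> q * (2 * r - s) + s * (q - 2 * p)"
    using * by (intro add_mono mult_left_mono) auto
  also have "\<dots> = 2 * (q * r - p * s)"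
    by (simp add: algebra_simps)
  also have "\<dots> \<le> 2"
    using le1 by simp
  finally have "q + s \<le> 2"
    by simp
  then have "q = 1 \<and> s = 1 \<and> p = 0 \<and> r = 1"
    using * by presburger
  then show ?thesis
    by (auto simp: pqrs vec_eq_iff forall_2 mat_def)
qed

text \<open>The row equations record that the denominators are kept and the endpoint values are
  reflected in 1/2.\<close>

lemma farey_split_psi:
  assumes "farey M"
  obtains N where "farey N" "lft M = psi \<circ> lft N" "N$2 = M$2" "N$1 = M$2 - M$1"
proof
  let ?N = "mat_B ** M"
  show row: "?N$2 = M$2" "?N$1 = M$2 - M$1"
    by (simp_all add: vec_eq_iff forall_2 matrix_matrix_mult_def sum_2 mat_B_def)
  have "det ?N = - det M"
    by (simp add: det_mul) (simp add: det_2 mat_B_def)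
  then have N: "?N \<in> carrier GL2Z"
    using assms by (auto simp: farey_def GL2Z_def)
  with assms row show "farey ?N"
    by (auto simp: farey_def)
  have "lft ?N = psi \<circ> lft M"
    using assms by (simp add: farey_def lft_mult lft_mat_B)
  then show "lft M = psi \<circ> lft ?N"
    by (simp add: o_assoc psi_psi)
qed

text \<open>The witness is the inverse of \<open>mat_A\<close> times \<open>M\<close>; values at
  most 1/2 are what keeps p/(q-p) and r/(s-r) in [0,1]. The measure is q + s. It drops by p + r,
  which is positive because p = r = 0 would make the top row, hence the determinant, vanish.\<close>

lemma farey_split_phi:
  assumes M: "farey M" and le: "2 * M$1$2 \<le> M$2$2" "2 * (M$1$1 + M$1$2) \<le> M$2$1 + M$2$2"
  obtains N where "farey N" "lft M = phi \<circ> lft N"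
    "N$2$1 + 2 * N$2$2 < M$2$1 + 2 * M$2$2"
proof
  let ?N = "vector [vector [M$1$1, M$1$2], vector [M$2$1 - M$1$1, M$2$2 - M$1$2]] :: int^2^2"
  have "det ?N = det M"
    by (simp add: det_2 algebra_simps)
  then have N: "?N \<in> carrier GL2Z"
    using M by (simp add: farey_def GL2Z_def)
  with M le show "farey ?N"
    by (auto simp: farey_def)
  have "M = mat_A ** ?N"
    by (simp add: vec_eq_iff forall_2 matrix_matrix_mult_def sum_2 mat_A_def)
  then show "lft M = phi \<circ> lft ?N"
    using lft_mult[OF N, of mat_A] by (simp add: lft_mat_A)
  have "\<not> (M$1$2 = 0 \<and> M$1$1 = 0)"
    using M by (auto simp: farey_def GL2Z_def det_2)
  then show "?N$2$1 + 2 * ?N$2$2 < M$2$1 + 2 * M$2$2"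
    using M by (auto simp: farey_def)
qed

lemma farey_generated:
  "farey M \<Longrightarrow> lft M \<in> semigroup_generated {phi, psi}"
proof (induction "nat (M$2$1 + 2 * M$2$2)" arbitrary: M rule: less_induct)
  case less
  let ?G = "semigroup_generated {phi, psi}"
  have gens: "phi \<in> ?G" "psi \<in> ?G"
    by (simp_all add: semigroup_generated.gen)
  \<comment> \<open>Fixing only the bottom row, and so the measure, makes this apply both to
    \<open>M\<close> and to its reflection.\<close>
  have low: "lft K \<in> ?G"
    if K: "farey K" "K$2 = M$2" "2 * K$1$2 \<le> K$2$2" "2 * (K$1$1 + K$1$2) \<le> K$2$1 + K$2$2" for K
  proof -
    obtain N where N: "farey N" "lft K = phi \<circ> lft N" "N$2$1 + 2 * N$2$2 < K$2$1 + 2 * K$2$2"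
      using farey_split_phi K by blast
    \<comment> \<open>Positivity carries the strict decrease over to \<open>nat\<close>.\<close>
    have "0 < N$2$1 + 2 * N$2$2"
      using N(1) by (simp add: farey_def)
    with N K(2) have "lft N \<in> ?G"
      using less.hyps[of N] by simp
    with N(2) gens show ?thesis
      by (simp add: semigroup_generated.comp)
  qed
  obtain N where N: "farey N" "lft M = psi \<circ> lft N" "N$2 = M$2" "N$1 = M$2 - M$1"
    using farey_split_psi less.prems by blast
  consider
      "2 * M$1$2 \<le> M$2$2" "2 * (M$1$1 + M$1$2) \<le> M$2$1 + M$2$2"
    | "2 * M$1$2 \<ge> M$2$2" "2 * (M$1$1 + M$1$2) \<ge> M$2$1 + M$2$2"
    | "2 * M$1$2 < M$2$2" "2 * (M$1$1 + M$1$2) > M$2$1 + M$2$2"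
    | "2 * M$1$2 > M$2$2" "2 * (M$1$1 + M$1$2) < M$2$1 + M$2$2"
    by linarith
  then show ?case
  proof cases
    case 1
    then show ?thesis using low less.prems by blast
  next
    case 2
    then have "lft N \<in> ?G"
      using low N by simp
    then show ?thesis
      using N(2) gens by (simp add: semigroup_generated.comp)
  next
    case 3
    then have "M = mat 1"
      using farey_straddles_half less.prems by simp
    then show ?thesis
      by (simp add: lft_mat_1 id_generated)
  next
    \<comment> \<open>The values straddle 1/2 in decreasing order; reflection makes the order
      increasing, so the map is \<open>psi\<close> itself.\<close>
    case 4
    then have "N = mat 1"
      using farey_straddles_half N by simp
    then show ?thesis
      using N(2) gens by (simp add: lft_mat_1)
  qed
qed

lemma maps_unit_interval_farey:
  assumes M: "M \<in> carrier GL2Z" and unit: "maps_unit_interval (lft M)" and d: "0 \<le> M$2$2"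
  shows "farey M"
proof -
  define a b c d where abcd: "a = real_of_int (M$1$1)" "b = real_of_int (M$1$2)"
    "c = real_of_int (M$2$1)" "d = real_of_int (M$2$2)"
  have val: "c * t + d \<noteq> 0 \<and> (a * t + b) / (c * t + d) \<in> {0..1}" if "t \<in> {0..1}" for t
  proof -
    have "lft M (Some t) \<in> Some ` {0..1}"
      using unit that by (auto simp: maps_unit_interval_def)
    then show ?thesis
      by (auto simp: lft_def abcd Let_def split: if_splits)
  qed
  have d_pos: "d > 0"
    using val[of 0] d abcd by simp
  \<comment> \<open>Otherwise the denominator, positive at 0, would have its root - d / c in [0,1],
    a pole.\<close>
  have cd_pos: "c + d > 0"
  proof (rule ccontr)
    assume "\<not> c + d > 0"
    then have "c < 0"
      using d_pos by simp
    moreover from this \<open>\<not> c + d > 0\<close> d_pos have "- d / c \<in> {0..1}"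
      by (simp add: neg_le_divide_eq divide_le_0_iff)
    ultimately show False
      using val[of "- d / c"] by simp
  qed
  have "0 \<le> b" "b \<le> d" "0 \<le> a + b" "a + b \<le> c + d"
    using val[of 0] val[of 1] d_pos cd_pos by (simp_all add: zero_le_divide_iff)
  with d_pos cd_pos M show ?thesis
    unfolding farey_def abcd by linarith
qed

theorem theorem1:
  "represents (mat_class mat_A) phi \<and> represents (mat_class mat_B) psi \<and>
   lft_semigroup = semigroup_generated {phi, psi}"
proof (intro conjI equalityI subsetI)
  show "represents (mat_class mat_A) phi" "represents (mat_class mat_B) psi"
    using mat_A_carrier mat_B_carrier lft_mat_A lft_mat_B by (auto simp: represents_iff)
next
  fix f assume f: "f \<in> lft_semigroup"
  then obtain M where M: "M \<in> carrier GL2Z" "f = lft M"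
    by (auto simp: lft_semigroup_iff)
  have neg: "- M \<in> carrier GL2Z" "f = lft (- M)"
    using M by (simp_all add: GL2Z_def det_2 lft_uminus)
  \<comment> \<open>Both signs represent \<open>f\<close>, and one of them has a nonnegative lower
    right entry.\<close>
  have "farey M \<or> farey (- M)"
    using maps_unit_interval_farey[of M] maps_unit_interval_farey[of "- M"] M neg f
    by (cases "0 \<le> M$2$2") (auto simp: lft_semigroup_iff)
  then show "f \<in> semigroup_generated {phi, psi}"
    using farey_generated M(2) neg(2) by metis
next
  fix f assume "f \<in> semigroup_generated {phi, psi}"
  then show "f \<in> lft_semigroup"
    by induction (auto simp del: comp_apply
        intro: phi_in_lft_semigroup psi_in_lft_semigroup comp_in_lft_semigroup)
qed

end
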